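(* Let $\epsilon\in\{1,-1\}$. Let $G_0$ be the connected simply connected real Lie group with Lie algebra $M14_1$ (basis $x_1,\dots,x_6$, nonzero brackets $[x_1,x_3]=x_4$, $[x_1,x_4]=x_6$, $[x_2,x_3]=x_5$, $[x_2,x_5]=x_6$), with the global coordinates $(x^1,y^1,x^2,y^2,x^3,y^3)$ given by $$x=\exp(x^1x_1)\exp(y^1x_2)\exp(x^2x_3)\exp(y^2x_4)\exp(x^3x_5)\exp(y^3x_6).$$ Let $G$ be $G_0$ endowed with the left invariant structure of complex manifold defined by the complex structure $J$ on $M14_1$ with $Jx_1=x_2$, $Jx_4=x_5$, $Jx_6=\epsilon x_3$. Put $w^1=x^1+iy^1$, $w^2=x^2-i\epsilon y^3$, $w^3=x^3-iy^2$ and $$\varphi^1=w^1,\qquad\varphi^2=w^2+\frac{\epsilon}{2}\,w^3\,\overline{w^1},\qquad\varphi^3=w^3.$$ Then $\varphi^1,\varphi^2,\varphi^3$ are holomorphic functions on $G$, and $F=(\varphi^1,\varphi^2,\varphi^3):G\to\mathbb{C}^3$ is a global holomorphic chart on $G$.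
   Context: Brackets of basis vectors not listed (and not obtained by antisymmetry) are zero. A complex structure on a real Lie algebra $\mathfrak{g}$ is a linear map $J$ with $J^2=-1$ and $[JX,JY]-[X,Y]-J[JX,Y]-J[X,JY]=0$ for all $X,Y\in\mathfrak{g}$. It extends uniquely to a left invariant almost complex structure on $G_0$, which is integrable by the Newlander–Nirenberg theorem; $G$ denotes $G_0$ with the resulting complex manifold structure. A smooth function $f:G_0\to\mathbb{C}$ is holomorphic on $G$ if and only if $(X+iJX)f=0$ for all left invariant vector fields $X$, where the left invariant vector field associated with $x_j$ is $(X_jf)(x)=\frac{d}{dt}f(x\exp(tx_j))|_{t=0}$. *)

theory Defs
  imports "HOL-Analysis.Analysis" "HOL-Algebra.Group"
begin

section \<open>Smooth maps between Euclidean spaces\<close>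

text \<open>
  \<open>Ck_on k S f\<close> is meant for open \<open>S\<close>: all iterated directional derivatives of \<open>f\<close> of order
  below \<open>k\<close> are (Frechet) differentiable on \<open>S\<close>, and those of order \<open>k\<close> are continuous.
\<close>

primrec Ck_on ::
  "nat \<Rightarrow> 'a::euclidean_space set \<Rightarrow> ('a \<Rightarrow> 'b::real_normed_vector) \<Rightarrow> bool" where
  "Ck_on 0 S f \<longleftrightarrow> continuous_on S f"
| "Ck_on (Suc k) S f \<longleftrightarrow>
     (\<forall>x\<in>S. f differentiable (at x)) \<and> (\<forall>v. Ck_on k S (\<lambda>x. frechet_derivative f (at x) v))"

definition smooth_on ::
  "'a::euclidean_space set \<Rightarrow> ('a \<Rightarrow> 'b::real_normed_vector) \<Rightarrow> bool" where
  "smooth_on S f \<longleftrightarrow> (\<forall>k. Ck_on k S f)"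


section \<open>Manifolds given by an atlas on a topological space\<close>

definition chart :: "'m::topological_space set \<times> ('m \<Rightarrow> 'e::euclidean_space) \<Rightarrow> bool" where
  "chart = (\<lambda>(U, \<phi>). open U \<and> open (\<phi> ` U) \<and> homeomorphism U (\<phi> ` U) \<phi> (inv_into U \<phi>))"

definition smooth_atlas ::
  "('m::{t2_space,second_countable_topology} set \<times> ('m \<Rightarrow> 'e::euclidean_space)) set \<Rightarrow> bool" where
  "smooth_atlas A \<longleftrightarrow>
     (\<forall>c\<in>A. chart c) \<and> (\<Union>(U, \<phi>)\<in>A. U) = UNIV \<and>
     (\<forall>(U, \<phi>)\<in>A. \<forall>(V, \<psi>)\<in>A. smooth_on (\<phi> ` (U \<inter> V)) (\<psi> \<circ> inv_into U \<phi>))"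

text \<open>Smoothness, on an open set \<open>W\<close>, of a map from the manifold into a normed space.\<close>

definition smooth_fun_on ::
  "('m::topological_space set \<times> ('m \<Rightarrow> 'e::euclidean_space)) set \<Rightarrow> 'm set
     \<Rightarrow> ('m \<Rightarrow> 'b::real_normed_vector) \<Rightarrow> bool" where
  "smooth_fun_on A W f \<longleftrightarrow> (\<forall>(U, \<phi>)\<in>A. smooth_on (\<phi> ` (U \<inter> W)) (f \<circ> inv_into U \<phi>))"

text \<open>Smoothness, on an open set \<open>S\<close>, of a map from a Euclidean space into the manifold.\<close>

definition smooth_into ::
  "('m::topological_space set \<times> ('m \<Rightarrow> 'e::euclidean_space)) set \<Rightarrow> 'a::euclidean_space set
     \<Rightarrow> ('a \<Rightarrow> 'm) \<Rightarrow> bool" where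
  "smooth_into A S g \<longleftrightarrow>
     continuous_on S g \<and> (\<forall>(U, \<phi>)\<in>A. smooth_on (S \<inter> g -` U) (\<phi> \<circ> g))"

text \<open>A diffeomorphism of the whole manifold onto a whole Euclidean space.\<close>

definition global_coordinates ::
  "('m::topological_space set \<times> ('m \<Rightarrow> 'e::euclidean_space)) set
     \<Rightarrow> ('m \<Rightarrow> 'b::euclidean_space) \<Rightarrow> bool" where
  "global_coordinates A c \<longleftrightarrow>
     bij c \<and> smooth_fun_on A UNIV c \<and> smooth_into A UNIV (inv_into UNIV c)"


section \<open>Lie groups, their Lie algebras and exponential maps\<close>

text \<open>Smoothness of multiplication and inversion is read in the charts of the factors.\<close>

locale lie_group = group G
  for G :: "'g::{t2_space,second_countable_topology} monoid" (structure) +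
  fixes A :: "('g set \<times> ('g \<Rightarrow> 'e::euclidean_space)) set"
  assumes carrier_UNIV: "carrier G = UNIV"
    and atlas: "smooth_atlas A"
    and smooth_mult: "\<lbrakk>(U, \<phi>) \<in> A; (V, \<psi>) \<in> A\<rbrakk> \<Longrightarrow>
        smooth_into A (\<phi> ` U \<times> \<psi> ` V) (\<lambda>(a, b). inv_into U \<phi> a \<otimes> inv_into V \<psi> b)"
    and smooth_inv: "(U, \<phi>) \<in> A \<Longrightarrow> smooth_into A (\<phi> ` U) (\<lambda>a. inv (inv_into U \<phi> a))"

text \<open>
  A vector field is a derivation of the sheaf of smooth real functions. It is encoded as an
  operator on all functions: \<open>X f x\<close> depends only on the germ of \<open>f\<close> at \<open>x\<close> if \<open>f\<close> is smooth
  near \<open>x\<close>, and is \<open>0\<close> otherwise, so that equal vector fields are equal as operators.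
\<close>

definition vector_field ::
  "('m::topological_space set \<times> ('m \<Rightarrow> 'e::euclidean_space)) set
     \<Rightarrow> (('m \<Rightarrow> real) \<Rightarrow> 'm \<Rightarrow> real) \<Rightarrow> bool" where
  "vector_field A X \<longleftrightarrow>
     (\<forall>W f. open W \<and> smooth_fun_on A W f \<longrightarrow> smooth_fun_on A W (X f)) \<and>
     (\<forall>W f h x. open W \<and> x \<in> W \<and> smooth_fun_on A W f \<and> smooth_fun_on A W h \<longrightarrow>
        ((\<forall>y\<in>W. f y = h y) \<longrightarrow> X f x = X h x) \<and>
        X (\<lambda>y. f y + h y) x = X f x + X h x \<and>
        (\<forall>r. X (\<lambda>y. r * f y) x = r * X f x) \<and>
        X (\<lambda>y. f y * h y) x = f x * X h x + X f x * h x) \<and>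
     (\<forall>f x. (\<nexists>W. open W \<and> x \<in> W \<and> smooth_fun_on A W f) \<longrightarrow> X f x = 0)"

definition left_invariant_field ::
  "'g::topological_space monoid \<Rightarrow> ('g set \<times> ('g \<Rightarrow> 'e::euclidean_space)) set
     \<Rightarrow> (('g \<Rightarrow> real) \<Rightarrow> 'g \<Rightarrow> real) \<Rightarrow> bool" where
  "left_invariant_field G A X \<longleftrightarrow> vector_field A X \<and>
     (\<forall>W f g x. open W \<and> smooth_fun_on A W f \<and> g \<otimes>\<^bsub>G\<^esub> x \<in> W \<longrightarrow>
        X (\<lambda>y. f (g \<otimes>\<^bsub>G\<^esub> y)) x = X f (g \<otimes>\<^bsub>G\<^esub> x))"

text \<open>
  \<open>L\<close> is an isomorphism from the Lie algebra with underlying space \<open>'v\<close> and bracket \<open>br\<close> onto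
  the Lie algebra of left invariant vector fields with the commutator bracket.
\<close>

definition lie_algebra_iso ::
  "'g::topological_space monoid \<Rightarrow> ('g set \<times> ('g \<Rightarrow> 'e::euclidean_space)) set
     \<Rightarrow> ('v::real_vector \<Rightarrow> 'v \<Rightarrow> 'v) \<Rightarrow> ('v \<Rightarrow> ('g \<Rightarrow> real) \<Rightarrow> 'g \<Rightarrow> real) \<Rightarrow> bool" where
  "lie_algebra_iso G A br L \<longleftrightarrow>
     bij_betw L UNIV {X. left_invariant_field G A X} \<and>
     (\<forall>W f x. open W \<and> smooth_fun_on A W f \<and> x \<in> W \<longrightarrow>
        linear (\<lambda>v. L v f x) \<and>
        (\<forall>v w. L (br v w) f x = L v (L w f) x - L w (L v f) x))"

text \<open>
  \<open>E\<close> is the exponential map, with the Lie algebra identified with \<open>'v\<close> through \<open>L\<close>: for each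
  \<open>v\<close>, \<open>t \<mapsto> E (t v)\<close> is the one-parameter subgroup with velocity \<open>L v\<close> at the identity.
\<close>

definition exponential_map ::
  "'g::topological_space monoid \<Rightarrow> ('g set \<times> ('g \<Rightarrow> 'e::euclidean_space)) set
     \<Rightarrow> ('v::real_vector \<Rightarrow> ('g \<Rightarrow> real) \<Rightarrow> 'g \<Rightarrow> real) \<Rightarrow> ('v \<Rightarrow> 'g) \<Rightarrow> bool" where
  "exponential_map G A L E \<longleftrightarrow> (\<forall>v.
     smooth_into A UNIV (\<lambda>t::real. E (t *\<^sub>R v)) \<and>
     (\<forall>s t. E ((s + t) *\<^sub>R v) = E (s *\<^sub>R v) \<otimes>\<^bsub>G\<^esub> E (t *\<^sub>R v)) \<and>
     (\<forall>W f. open W \<and> \<one>\<^bsub>G\<^esub> \<in> W \<and> smooth_fun_on A W f \<longrightarrow>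
        ((\<lambda>t. f (E (t *\<^sub>R v))) has_real_derivative L v f \<one>\<^bsub>G\<^esub>) (at 0)))"

text \<open>
  Derivative along the left invariant vector field of \<open>v\<close>; in contrast to \<open>L v\<close> it also applies
  to complex valued functions.
\<close>

definition left_inv_deriv ::
  "'g monoid \<Rightarrow> ('v::real_vector \<Rightarrow> 'g) \<Rightarrow> 'v \<Rightarrow> ('g \<Rightarrow> 'b::real_normed_vector) \<Rightarrow> 'g \<Rightarrow> 'b" where
  "left_inv_deriv G E v f x = vector_derivative (\<lambda>t. f (x \<otimes>\<^bsub>G\<^esub> E (t *\<^sub>R v))) (at 0)"


section \<open>Left invariant complex structures\<close>

definition complex_structure :: "('v::real_vector \<Rightarrow> 'v \<Rightarrow> 'v) \<Rightarrow> ('v \<Rightarrow> 'v) \<Rightarrow> bool" where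
  "complex_structure br J \<longleftrightarrow> linear J \<and> (\<forall>X. J (J X) = - X) \<and>
     (\<forall>X Y. br (J X) (J Y) - br X Y - J (br (J X) Y) - J (br X (J Y)) = 0)"

text \<open>
  Holomorphic functions on open subsets of the complex manifold that the Lie group becomes
  through the left invariant almost complex structure defined by \<open>J\<close>.
\<close>

definition lie_holomorphic_on ::
  "'g::topological_space monoid \<Rightarrow> ('g set \<times> ('g \<Rightarrow> 'e::euclidean_space)) set
     \<Rightarrow> ('v::real_vector \<Rightarrow> 'g) \<Rightarrow> ('v \<Rightarrow> 'v) \<Rightarrow> 'g set \<Rightarrow> ('g \<Rightarrow> complex) \<Rightarrow> bool" where
  "lie_holomorphic_on G A E J W f \<longleftrightarrow> smooth_fun_on A W f \<and>
     (\<forall>x\<in>W. \<forall>v. left_inv_deriv G E v f x + \<i> * left_inv_deriv G E (J v) f x = 0)"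

definition holomorphic_several_on :: "(complex^'n) set \<Rightarrow> (complex^'n \<Rightarrow> complex) \<Rightarrow> bool" where
  "holomorphic_several_on S h \<longleftrightarrow>
     (\<forall>z\<in>S. \<exists>D. (h has_derivative D) (at z) \<and> (\<forall>v. D (\<i> *s v) = \<i> * D v))"

text \<open>
  A biholomorphism from the complex manifold onto the whole of complex \<open>'n\<close>-space: a
  diffeomorphism that is holomorphic together with its inverse.
\<close>

definition global_holomorphic_chart ::
  "'g::topological_space monoid \<Rightarrow> ('g set \<times> ('g \<Rightarrow> 'e::euclidean_space)) set
     \<Rightarrow> ('v::real_vector \<Rightarrow> 'g) \<Rightarrow> ('v \<Rightarrow> 'v) \<Rightarrow> ('g \<Rightarrow> complex^'n) \<Rightarrow> bool" where
  "global_holomorphic_chart G A E J F \<longleftrightarrow>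
     global_coordinates A F \<and>
     (\<forall>k. lie_holomorphic_on G A E J UNIV (\<lambda>p. F p $ k)) \<and>
     (\<forall>W f. open W \<and> lie_holomorphic_on G A E J W f \<longrightarrow>
        holomorphic_several_on (F ` W) (f \<circ> inv_into UNIV F))"


section \<open>The Lie algebra M14_1\<close>

abbreviation basis_x :: "6 \<Rightarrow> real^6" where
  "basis_x j \<equiv> axis j 1"

definition M14_bracket :: "real^6 \<Rightarrow> real^6 \<Rightarrow> real^6" where
  "M14_bracket u v =
     (u$1 * v$3 - u$3 * v$1) *\<^sub>R basis_x 4 +
     (u$1 * v$4 - u$4 * v$1) *\<^sub>R basis_x 6 +
     (u$2 * v$3 - u$3 * v$2) *\<^sub>R basis_x 5 +
     (u$2 * v$5 - u$5 * v$2) *\<^sub>R basis_x 6"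

lemma M14_bracket_basis:
  "M14_bracket (basis_x 1) (basis_x 3) = basis_x 4"
  "M14_bracket (basis_x 1) (basis_x 4) = basis_x 6"
  "M14_bracket (basis_x 2) (basis_x 3) = basis_x 5"
  "M14_bracket (basis_x 2) (basis_x 5) = basis_x 6"
  "\<lbrakk>{i, j} \<noteq> {1, 3}; {i, j} \<noteq> {1, 4}; {i, j} \<noteq> {2, 3}; {i, j} \<noteq> {2, 5}\<rbrakk> \<Longrightarrow>
     M14_bracket (basis_x i) (basis_x j) = 0"
  by (auto simp: M14_bracket_def axis_def)

lemma M14_bracket_lie:
  "bilinear M14_bracket"
  "M14_bracket u u = 0"
  "M14_bracket u (M14_bracket v w) + M14_bracket v (M14_bracket w u)
     + M14_bracket w (M14_bracket u v) = 0"
  by (auto simp: bilinear_def M14_bracket_def vec_eq_iff axis_def algebra_simps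
      intro!: linearI)

end

theory Submission
  imports Defs
begin

text \<open>
  In the given coordinates each left invariant field is a vector field on six-dimensional space,
  and the bracket relations are differential equations for its components. Coordinates of the second
  kind give \<open>X\<^sub>j = \<partial>\<^sub>j\<close> on the slice where all coordinates after the \<open>j\<close>-th
  vanish. Going down from \<open>X\<^sub>6\<close>, the brackets with the constant fields \<open>X\<^sub>3, \<dots>, X\<^sub>6\<close>
  propagate this from the slice to the whole space:
  \<open>X\<^sub>2 = \<partial>\<^sub>2 - t\<^sub>3 \<partial>\<^sub>5 - t\<^sub>5 \<partial>\<^sub>6\<close> and
  \<open>X\<^sub>1 = \<partial>\<^sub>1 - t\<^sub>3 \<partial>\<^sub>4 - t\<^sub>4 \<partial>\<^sub>6\<close>.
  So neither flows nor the group law are needed, and holomorphy becomes an identity between polynomials.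
  The chart has a polynomial inverse, and its differential intertwines \<open>J\<close> with multiplication
  by \<open>\<i>\<close>; hence holomorphic functions on the group are exactly those holomorphic in the chart.
\<close>

section \<open>Calculus of smooth maps\<close>

lemma frechet_derivative_cong_open:
  assumes "open S" "x \<in> S" "\<And>y. y \<in> S \<Longrightarrow> f y = g y" "f differentiable (at x)"
  shows "g differentiable (at x)" "frechet_derivative g (at x) = frechet_derivative f (at x)"
proof -
  have "(f has_derivative frechet_derivative f (at x)) (at x)"
    using assms(4) by (simp add: frechet_derivative_works)
  then have g: "(g has_derivative frechet_derivative f (at x)) (at x)"
    by (rule has_derivative_transform_within_open[OF _ assms(1,2)]) (use assms(3) in auto)
  then show "g differentiable (at x)" by (rule differentiableI)
  show "frechet_derivative g (at x) = frechet_derivative f (at x)"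
    using frechet_derivative_at[OF g] by simp
qed

lemma Ck_on_cong:
  assumes "open S" "\<And>x. x \<in> S \<Longrightarrow> f x = g x" "Ck_on k S f"
  shows "Ck_on k S g"
  using assms(2,3)
proof (induction k arbitrary: f g)
  case 0
  then show ?case using continuous_on_cong[of S S f g] by simp
next
  case (Suc k)
  have d: "f differentiable (at x)" if "x \<in> S" for x using Suc.prems(2) that by simp
  note F = frechet_derivative_cong_open[OF assms(1) _ Suc.prems(1) d]
  show ?case
    unfolding Ck_on.simps
  proof (intro conjI ballI allI)
    show "g differentiable (at x)" if "x \<in> S" for x using F(1) that by blast
    show "Ck_on k S (\<lambda>x. frechet_derivative g (at x) v)" for v
      by (rule Suc.IH[of "\<lambda>x. frechet_derivative f (at x) v"]) (use Suc.prems(2) F(2) in auto)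
  qed
qed

lemma Ck_on_subset: "Ck_on k S f \<Longrightarrow> T \<subseteq> S \<Longrightarrow> Ck_on k T f"
proof (induction k arbitrary: f)
  case 0
  then show ?case by (auto intro: continuous_on_subset)
next
  case (Suc k)
  then show ?case by auto
qed

text \<open>\<open>Ck_on\<close> speaks of \<open>frechet_derivative\<close>, which is given by
  choice. By uniqueness of derivatives an explicit \<open>f'\<close> agrees with it on the open set
  and may replace it there.\<close>

lemma Ck_on_SucI:
  assumes "open S" "\<And>x. x \<in> S \<Longrightarrow> (f has_derivative f' x) (at x)" "\<And>v. Ck_on k S (\<lambda>x. f' x v)"
  shows "Ck_on (Suc k) S f"
proof -
  have "frechet_derivative f (at x) = f' x" if "x \<in> S" for x
    using frechet_derivative_at[OF assms(2)[OF that]] by simp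
  then have "Ck_on k S (\<lambda>x. frechet_derivative f (at x) v)" for v
    by (intro Ck_on_cong[OF assms(1) _ assms(3)[of v]]) simp
  moreover have "\<forall>x\<in>S. f differentiable (at x)"
    using assms(2) by (auto intro: differentiableI)
  ultimately show ?thesis by simp
qed

lemma Ck_on_SucE:
  assumes "Ck_on (Suc k) S f"
  shows "x \<in> S \<Longrightarrow> (f has_derivative frechet_derivative f (at x)) (at x)"
    and "Ck_on k S (\<lambda>x. frechet_derivative f (at x) v)"
  using assms by (simp_all add: frechet_derivative_works)

lemma Ck_on_SucD: "Ck_on (Suc k) S f \<Longrightarrow> Ck_on k S f"
proof (induction k arbitrary: f)
  case 0
  then have "f differentiable_on S"
    by (auto simp: differentiable_on_def intro: differentiable_at_withinI)
  then show ?case using differentiable_imp_continuous_on by auto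
next
  case (Suc k)
  have "Ck_on k S (\<lambda>x. frechet_derivative f (at x) v)" for v
    by (rule Suc.IH[OF Ck_on_SucE(2)[OF Suc.prems]])
  moreover have "\<forall>x\<in>S. f differentiable (at x)"
    using Ck_on_SucE(1)[OF Suc.prems] by (blast intro: differentiableI)
  ultimately show ?case by simp
qed

text \<open>Derivatives depend only on germs, so every order can be checked near each point. This
  glues smoothness obtained chart by chart.\<close>

lemma Ck_on_locally:
  assumes "\<And>x. x \<in> S \<Longrightarrow> \<exists>T. open T \<and> x \<in> T \<and> Ck_on k T f"
  shows "Ck_on k S f"
  using assms
proof (induction k arbitrary: f)
  case 0
  have "continuous (at x within S) f" if x: "x \<in> S" for x
  proof -
    obtain T where "open T" "x \<in> T" "continuous_on T f" using 0[OF x] by auto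
    then have "continuous (at x) f" by (simp add: continuous_on_eq_continuous_at)
    then show ?thesis by (rule continuous_at_imp_continuous_at_within)
  qed
  then show ?case by (simp add: continuous_on_eq_continuous_within)
next
  case (Suc k)
  have "\<exists>T. open T \<and> x \<in> T \<and> Ck_on k T (\<lambda>x. frechet_derivative f (at x) v)" if x: "x \<in> S" for x v
  proof -
    obtain T where T: "open T" "x \<in> T" "Ck_on (Suc k) T f" using Suc.prems[OF x] by auto
    from T(1,2) Ck_on_SucE(2)[OF T(3), of v] show ?thesis by auto
  qed
  then have "Ck_on k S (\<lambda>x. frechet_derivative f (at x) v)" for v by (rule Suc.IH)
  moreover have "f differentiable (at x)" if "x \<in> S" for x
    using Suc.prems[OF that] by auto
  ultimately show ?case by simp
qed

section \<open>Closure of C^k maps under linear, bilinear and composite operations\<close>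

lemma Ck_on_const: "Ck_on k S (\<lambda>x. c)"
  by (induction k arbitrary: c) simp_all

lemma Ck_on_bounded_linear:
  assumes "open S" "bounded_linear h" "Ck_on k S f"
  shows "Ck_on k S (\<lambda>x. h (f x))"
  using assms(3)
proof (induction k arbitrary: f)
  case 0
  then show ?case using bounded_linear.continuous_on[OF assms(2)] by simp
next
  case (Suc k)
  show ?case
  proof (rule Ck_on_SucI[OF assms(1)])
    fix x assume "x \<in> S"
    from bounded_linear.has_derivative[OF assms(2) Ck_on_SucE(1)[OF Suc.prems this]]
    show "((\<lambda>x. h (f x)) has_derivative (\<lambda>v. h (frechet_derivative f (at x) v))) (at x)" .
  qed (rule Suc.IH[OF Ck_on_SucE(2)[OF Suc.prems]])
qed

lemma Ck_on_add:
  assumes "open S" "Ck_on k S f" "Ck_on k S g"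
  shows "Ck_on k S (\<lambda>x. f x + g x)"
  using assms(2,3)
proof (induction k arbitrary: f g)
  case 0
  then show ?case by (simp add: continuous_on_add)
next
  case (Suc k)
  show ?case
  proof (rule Ck_on_SucI[OF assms(1)])
    fix x assume "x \<in> S"
    then show "((\<lambda>x. f x + g x) has_derivative
        (\<lambda>v. frechet_derivative f (at x) v + frechet_derivative g (at x) v)) (at x)"
      by (intro has_derivative_add Ck_on_SucE(1)[OF Suc.prems(1)] Ck_on_SucE(1)[OF Suc.prems(2)])
  qed (rule Suc.IH[OF Ck_on_SucE(2)[OF Suc.prems(1)] Ck_on_SucE(2)[OF Suc.prems(2)]])
qed

lemma Ck_on_sum:
  assumes "open S" "\<And>i. i \<in> I \<Longrightarrow> Ck_on k S (f i)"
  shows "Ck_on k S (\<lambda>x. \<Sum>i\<in>I. f i x)"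
  using assms(2)
  by (induction I rule: infinite_finite_induct) (auto intro: Ck_on_const Ck_on_add assms(1))

text \<open>Each summand of the product rule pairs a derivative of order \<open>k\<close> with an
  undifferentiated factor of order \<open>Suc k\<close>. Lowering the latter by
  \<open>Ck_on_SucD\<close> makes the induction hypothesis applicable.\<close>

lemma Ck_on_bilinear:
  assumes "open S" "bounded_bilinear m" "Ck_on k S f" "Ck_on k S g"
  shows "Ck_on k S (\<lambda>x. m (f x) (g x))"
  using assms(3,4)
proof (induction k arbitrary: f g)
  case 0
  then show ?case using bounded_bilinear.continuous_on[OF assms(2)] by simp
next
  case (Suc k)
  show ?case
  proof (rule Ck_on_SucI[OF assms(1)])
    fix x assume "x \<in> S"
    then show "((\<lambda>x. m (f x) (g x)) has_derivative (\<lambda>v. m (f x) (frechet_derivative g (at x) v)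
        + m (frechet_derivative f (at x) v) (g x))) (at x)"
      by (intro bounded_bilinear.FDERIV[OF assms(2)] Ck_on_SucE(1)[OF Suc.prems(1)]
          Ck_on_SucE(1)[OF Suc.prems(2)])
  next
    fix v
    show "Ck_on k S (\<lambda>x. m (f x) (frechet_derivative g (at x) v)
        + m (frechet_derivative f (at x) v) (g x))"
      by (intro Ck_on_add[OF assms(1)] Suc.IH Ck_on_SucD[OF Suc.prems(1)]
          Ck_on_SucD[OF Suc.prems(2)] Ck_on_SucE(2)[OF Suc.prems(1)] Ck_on_SucE(2)[OF Suc.prems(2)])
  qed
qed

lemma Ck_on_id: "Ck_on k S (\<lambda>x. x)"
proof (cases k)
  case (Suc n)
  have "Ck_on (Suc n) UNIV (\<lambda>x::'a. x)"
    by (rule Ck_on_SucI[where f' = "\<lambda>x v. v"]) (auto intro: Ck_on_const)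
  then show ?thesis unfolding Suc by (rule Ck_on_subset) simp
qed simp

lemma Ck_on_compose:
  fixes f :: "'b::euclidean_space \<Rightarrow> 'c::real_normed_vector"
  assumes "open S" "g ` S \<subseteq> T" "Ck_on k T f" "Ck_on k S g"
  shows "Ck_on k S (\<lambda>x. f (g x))"
  using assms(3,4)
proof (induction k arbitrary: f)
  case 0
  then show ?case using continuous_on_compose2[of T f S g] assms(2) by simp
next
  case (Suc k)
  note f = Ck_on_SucE[OF Suc.prems(1)] and g = Ck_on_SucE[OF Suc.prems(2)]
  let ?Df = "\<lambda>y. frechet_derivative f (at y)" and ?Dg = "\<lambda>x. frechet_derivative g (at x)"
  \<comment> \<open>The chain rule evaluates \<open>?Df\<close> in a direction that varies with
    \<open>x\<close>, whereas \<open>Ck_on\<close> controls fixed directions only. Expanding the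
    direction in the finite basis leaves fixed directions with C^k coefficients.\<close>
  have expand: "?Df (g x) u = (\<Sum>b\<in>Basis. (u \<bullet> b) *\<^sub>R ?Df (g x) b)" if "x \<in> S" for x u
  proof -
    have "g x \<in> T" using that assms(2) by auto
    then have "bounded_linear (?Df (g x))" by (rule has_derivative_bounded_linear[OF f(1)])
    then have "linear (?Df (g x))" by (rule bounded_linear.linear)
    from linear_sum[OF this, of "\<lambda>b. (u \<bullet> b) *\<^sub>R b" Basis] show ?thesis
      by (simp add: euclidean_representation linear_cmul[OF \<open>linear _\<close>])
  qed
  show ?case
  proof (rule Ck_on_SucI[OF assms(1)])
    fix x assume x: "x \<in> S"
    then have "g x \<in> T" using assms(2) by auto
    from has_derivative_compose[OF g(1)[OF x] f(1)[OF this]]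
    show "((\<lambda>x. f (g x)) has_derivative (\<lambda>v. ?Df (g x) (?Dg x v))) (at x)" .
  next
    fix v
    have "Ck_on k S (\<lambda>x. \<Sum>b\<in>Basis. (?Dg x v \<bullet> b) *\<^sub>R ?Df (g x) b)"
      by (intro Ck_on_sum Ck_on_bilinear[OF _ bounded_bilinear_scaleR] assms(1) Suc.IH f(2)
          Ck_on_bounded_linear[OF assms(1) bounded_linear_inner_left] g(2) Ck_on_SucD[OF Suc.prems(2)])
    then show "Ck_on k S (\<lambda>x. ?Df (g x) (?Dg x v))"
      by (rule Ck_on_cong[OF assms(1), rotated]) (simp add: expand[symmetric])
  qed
qed

lemma Ck_on_vec_lambda:
  fixes f :: "'a::euclidean_space \<Rightarrow> 'b::real_normed_vector^'n"
  assumes "open S" "\<And>i. Ck_on k S (\<lambda>x. f x $ i)"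
  shows "Ck_on k S f"
proof -
  have "bounded_linear (axis i :: 'b \<Rightarrow> 'b^'n)" for i
  proof (rule bounded_linear_intro[where K=1])
    show "norm (axis i x :: 'b^'n) \<le> norm x * 1" for x 
      by (simp add: norm_vec_def L2_set_def axis_def if_distrib[of norm] if_distrib[of "\<lambda>x. x\<^sup>2"]
          cong: if_cong)
  qed (simp_all add: axis_def vec_eq_iff)
  then have "Ck_on k S (\<lambda>x. \<Sum>i\<in>UNIV. axis i (f x $ i))"
    by (intro Ck_on_sum Ck_on_bounded_linear[where h = "axis _"] assms)
  moreover have "(\<Sum>i\<in>UNIV. axis i (y $ i)) = y" for y :: "'b^'n"
    by (simp add: vec_eq_iff axis_def if_distrib cong: if_cong)
  ultimately show ?thesis by simp
qed

lemma smooth_onD: "smooth_on S f \<Longrightarrow> x \<in> S \<Longrightarrow> f differentiable (at x)"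
  unfolding smooth_on_def by (drule spec[of _ "Suc 0"]) simp

lemma smooth_on_subset: "smooth_on S f \<Longrightarrow> T \<subseteq> S \<Longrightarrow> smooth_on T f"
  unfolding smooth_on_def using Ck_on_subset by metis

lemma smooth_on_compose:
  fixes f :: "'b::euclidean_space \<Rightarrow> 'c::real_normed_vector"
  assumes "open S" "g ` S \<subseteq> T" "smooth_on T f" "smooth_on S g"
  shows "smooth_on S (\<lambda>x. f (g x))"
  using assms Ck_on_compose unfolding smooth_on_def by blast

lemma smooth_on_linear:
  fixes h :: "'b::real_normed_vector \<Rightarrow> 'c::real_normed_vector"
  assumes "open S" "bounded_linear h" "smooth_on S f"
  shows "smooth_on S (\<lambda>x. h (f x))"
  using assms Ck_on_bounded_linear unfolding smooth_on_def by blast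

section \<open>Smooth maps between a manifold and Euclidean spaces\<close>

lemma chartD:
  assumes "smooth_atlas A" "(U, \<phi>) \<in> A"
  shows "open U"
    "\<And>x. x \<in> U \<Longrightarrow> inv_into U \<phi> (\<phi> x) = x"
    "\<And>W. open W \<Longrightarrow> open (\<phi> ` (U \<inter> W))"
proof -
  have ch: "chart (U, \<phi>)" using assms by (auto simp: smooth_atlas_def)
  then show "open U" by (simp add: chart_def)
  have h: "homeomorphism U (\<phi> ` U) \<phi> (inv_into U \<phi>)"
    using ch by (auto simp: chart_def)
  show "\<And>x. x \<in> U \<Longrightarrow> inv_into U \<phi> (\<phi> x) = x" using h by (simp add: homeomorphism_def)
  fix W :: "'a set" assume "open W"
  then have "openin (top_of_set U) (U \<inter> W)" by (simp add: openin_open_Int)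
  then have "openin (top_of_set (\<phi> ` U)) (\<phi> ` (U \<inter> W))"
    by (rule homeomorphism_imp_open_map[OF h])
  then show "open (\<phi> ` (U \<inter> W))"
    using ch openin_open_trans by (auto simp: chart_def)
qed

lemma chart_covering:
  assumes "smooth_atlas A"
  obtains U \<phi> where "(U, \<phi>) \<in> A" "x \<in> U"
proof -
  have "x \<in> (\<Union>(U, \<phi>)\<in>A. U)" using assms by (simp add: smooth_atlas_def)
  then show ?thesis using that by auto
qed

text \<open>Over the preimage of a chart domain, \<open>f \<circ> g\<close> is
  \<open>(f \<circ> inv_into U \<phi>) \<circ> (\<phi> \<circ> g)\<close>, a composition between
  Euclidean spaces. These preimages are open and cover, so \<open>Ck_on_locally\<close>
  finishes.\<close>

lemma smooth_fun_on_smooth_into: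
  fixes A :: "('m::{t2_space,second_countable_topology} set \<times> ('m \<Rightarrow> 'e::euclidean_space)) set"
    and g :: "'a::euclidean_space \<Rightarrow> 'm"
  assumes A: "smooth_atlas A" and S: "open S" and W: "open W"
    and g: "smooth_into A S g" and f: "smooth_fun_on A W f"
  shows "open (S \<inter> g -` W)" "smooth_on (S \<inter> g -` W) (\<lambda>x. f (g x))"
proof -
  have op: "open (S \<inter> g -` X)" if "open X" for X
    using g S that by (simp add: smooth_into_def continuous_on_open_vimage Int_commute)
  show "open (S \<inter> g -` W)" by (rule op[OF W])
  have "\<exists>T. open T \<and> x \<in> T \<and> Ck_on k T (\<lambda>x. f (g x))" if x: "x \<in> S \<inter> g -` W" for x k
  proof -
    obtain U \<phi> where U: "(U, \<phi>) \<in> A" "g x \<in> U" using chart_covering[OF A] by blast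
    let ?T = "S \<inter> g -` (U \<inter> W)"
    have T: "open ?T" by (intro op open_Int chartD(1)[OF A U(1)] W)
    have 1: "Ck_on k (\<phi> ` (U \<inter> W)) (f \<circ> inv_into U \<phi>)"
      using f U by (auto simp: smooth_fun_on_def smooth_on_def)
    have "Ck_on k (S \<inter> g -` U) (\<phi> \<circ> g)"
      using g U(1) by (auto simp: smooth_into_def smooth_on_def)
    then have 2: "Ck_on k ?T (\<phi> \<circ> g)" by (rule Ck_on_subset) auto
    have "Ck_on k ?T (\<lambda>x. (f \<circ> inv_into U \<phi>) ((\<phi> \<circ> g) x))"
      by (rule Ck_on_compose[OF T _ 1 2]) auto
    then have "Ck_on k ?T (\<lambda>x. f (g x))"
      by (rule Ck_on_cong[OF T, rotated]) (simp add: chartD(2)[OF A U(1)])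
    then show ?thesis using T U x by (intro exI[of _ ?T]) auto
  qed
  then show "smooth_on (S \<inter> g -` W) (\<lambda>x. f (g x))"
    unfolding smooth_on_def by (intro allI Ck_on_locally)
qed

lemma smooth_fun_on_linear:
  assumes "smooth_atlas A" "open W" "bounded_linear h" "smooth_fun_on A W f"
  shows "smooth_fun_on A W (\<lambda>x. h (f x))"
  unfolding smooth_fun_on_def comp_def
proof clarify
  fix U \<phi> assume U: "(U, \<phi>) \<in> A"
  have "smooth_on (\<phi> ` (U \<inter> W)) (\<lambda>y. f (inv_into U \<phi> y))"
    using assms(4) U by (auto simp: smooth_fun_on_def comp_def)
  then show "smooth_on (\<phi> ` (U \<inter> W)) (\<lambda>y. h (f (inv_into U \<phi> y)))"
    by (rule smooth_on_linear[OF chartD(3)[OF assms(1) U assms(2)] assms(3)])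
qed

lemma smooth_fun_on_compose:
  fixes q :: "'b::euclidean_space \<Rightarrow> 'c::real_normed_vector"
  assumes "smooth_atlas A" "open W" "smooth_on UNIV q" "smooth_fun_on A W f"
  shows "smooth_fun_on A W (\<lambda>x. q (f x))"
  unfolding smooth_fun_on_def comp_def
proof clarify
  fix U \<phi> assume U: "(U, \<phi>) \<in> A"
  have "smooth_on (\<phi> ` (U \<inter> W)) (\<lambda>y. f (inv_into U \<phi> y))"
    using assms(4) U by (auto simp: smooth_fun_on_def comp_def)
  then show "smooth_on (\<phi> ` (U \<inter> W)) (\<lambda>y. q (f (inv_into U \<phi> y)))"
    by (rule smooth_on_compose[OF chartD(3)[OF assms(1) U assms(2)] subset_UNIV assms(3)])
qed

section \<open>Left invariant vector fields in global coordinates\<close>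

locale lie_group_coordinates = lie_group G A
  for G :: "'g::{t2_space,second_countable_topology} monoid" (structure)
    and A :: "('g set \<times> ('g \<Rightarrow> 'e::euclidean_space)) set" +
  fixes br :: "'v::real_vector \<Rightarrow> 'v \<Rightarrow> 'v"
    and L :: "'v \<Rightarrow> ('g \<Rightarrow> real) \<Rightarrow> 'g \<Rightarrow> real"
    and E :: "'v \<Rightarrow> 'g"
    and c :: "'g \<Rightarrow> 'b::euclidean_space"
  assumes iso: "lie_algebra_iso G A br L"
    and exponential: "exponential_map G A L E"
    and coordinates: "global_coordinates A c"
begin

abbreviation c' :: "'b \<Rightarrow> 'g" where
  "c' \<equiv> inv_into UNIV c"

text \<open>The coefficient vector of \<open>L v\<close> in the coordinates \<open>c\<close>: the
  components of a vector field are its values on the coordinate functions.\<close>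

definition field :: "'v \<Rightarrow> 'b \<Rightarrow> 'b" where
  "field v t = (\<Sum>b\<in>Basis. L v (\<lambda>p. c p \<bullet> b) (c' t) *\<^sub>R b)"

lemma c'_c [simp]: "c' (c p) = p" and c_c' [simp]: "c (c' t) = t"
proof -
  have "bij c" using coordinates by (simp add: global_coordinates_def)
  then show "c' (c p) = p" "c (c' t) = t"
    by (simp_all add: bij_is_inj bij_is_surj surj_f_inv_f)
qed

lemma smooth_c: "smooth_fun_on A UNIV c" and smooth_c': "smooth_into A UNIV c'"
  using coordinates by (simp_all add: global_coordinates_def)

lemma smooth_c_inner: "smooth_fun_on A UNIV (\<lambda>p. c p \<bullet> b)"
  by (rule smooth_fun_on_linear[OF atlas open_UNIV bounded_linear_inner_left smooth_c])

lemma smooth_fun_on_coordinates: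
  assumes "open W" "smooth_fun_on A W f"
  shows "open (c' -` W)" "smooth_on (c' -` W) (\<lambda>t. f (c' t))"
  using smooth_fun_on_smooth_into[OF atlas open_UNIV assms(1) smooth_c' assms(2)] by simp_all

section \<open>Left invariant fields as derivatives along one-parameter subgroups\<close>

lemma L_left_invariant: "left_invariant_field G A (L v)"
  using iso by (auto simp: lie_algebra_iso_def bij_betw_def)

lemma smooth_L: "open W \<Longrightarrow> smooth_fun_on A W f \<Longrightarrow> smooth_fun_on A W (L v f)"
  using L_left_invariant[of v] by (auto simp: left_invariant_field_def vector_field_def)

lemma linear_L: "smooth_fun_on A UNIV f \<Longrightarrow> linear (\<lambda>v. L v f x)"
  using iso by (auto simp: lie_algebra_iso_def)

lemma L_bracket:
  "smooth_fun_on A UNIV f \<Longrightarrow> L (br v w) f x = L v (L w f) x - L w (L v f) x"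
  using iso unfolding lie_algebra_iso_def by blast

text \<open>Multiplication is smooth on products of charts. Freezing its first argument at
  \<open>\<phi> x\<close> means composing with the affine map
  \<open>b \<mapsto> (\<phi> x, b)\<close>.\<close>

lemma smooth_left_translation:
  fixes f :: "'g \<Rightarrow> 'c::real_normed_vector"
  assumes f: "smooth_fun_on A UNIV f"
  shows "smooth_fun_on A UNIV (\<lambda>y. f (x \<otimes> y))"
  unfolding smooth_fun_on_def
proof clarify
  fix V \<psi> assume V: "(V, \<psi>) \<in> A"
  obtain U \<phi> where U: "(U, \<phi>) \<in> A" "x \<in> U" using chart_covering[OF atlas] by blast
  have op: "open (\<phi> ` U)" "open (\<psi> ` V)"
    using chartD(3)[OF atlas U(1) open_UNIV] chartD(3)[OF atlas V open_UNIV] by simp_all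
  from smooth_fun_on_smooth_into(2)[OF atlas open_Times[OF op] open_UNIV smooth_mult[OF U(1) V] f]
  have sm: "smooth_on (\<phi> ` U \<times> \<psi> ` V) (\<lambda>z. f (case z of (a, b) \<Rightarrow> inv_into U \<phi> a \<otimes> inv_into V \<psi> b))"
    by simp
  have "Ck_on k (\<psi> ` V) (\<lambda>b. (\<phi> x, 0) + (0, b))" for k
    by (intro Ck_on_add op(2) Ck_on_const Ck_on_bounded_linear[OF op(2), where h = "\<lambda>b. (0, b)"]
        Ck_on_id bounded_linear_intro[where K=1]) (auto simp: norm_Pair)
  then have "smooth_on (\<psi> ` V) (\<lambda>b. (\<phi> x, b))" by (simp add: smooth_on_def)
  from smooth_on_compose[OF op(2) _ sm this] U
  have "smooth_on (\<psi> ` V) (\<lambda>b. f (inv_into U \<phi> (\<phi> x) \<otimes> inv_into V \<psi> b))" by auto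
  then show "smooth_on (\<psi> ` (V \<inter> UNIV)) ((\<lambda>y. f (x \<otimes> y)) \<circ> inv_into V \<psi>)"
    using U by (simp add: comp_def chartD(2)[OF atlas])
qed

lemma E_add: "E ((s + t) *\<^sub>R v) = E (s *\<^sub>R v) \<otimes> E (t *\<^sub>R v)"
  using exponential by (simp add: exponential_map_def)

lemma E_zero [simp]: "E 0 = \<one>"
  \<comment> \<open>\<open>E 0\<close> is idempotent in a group, hence the identity.\<close>
  using E_add[of 0 0 0] carrier_UNIV by (simp add: l_cancel_one')

text \<open>The exponential map gives velocities at the identity only. Applying this to the
  translate of \<open>f\<close> by \<open>x\<close>, left invariance moves the derivative to
  \<open>x\<close>.\<close>

lemma L_eq_derivative:
  assumes f: "smooth_fun_on A UNIV f"
  shows "((\<lambda>t. f (x \<otimes> E (t *\<^sub>R v))) has_real_derivative L v f x) (at 0)"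
proof -
  have "((\<lambda>t. f (x \<otimes> E (t *\<^sub>R v))) has_real_derivative L v (\<lambda>y. f (x \<otimes> y)) \<one>) (at 0)"
    using exponential[unfolded exponential_map_def, rule_format, of v, THEN conjunct2, THEN conjunct2,
        rule_format, of UNIV "\<lambda>y. f (x \<otimes> y)"] smooth_left_translation[OF f, of x] by simp
  moreover have "L v (\<lambda>y. f (x \<otimes> y)) \<one> = L v f (x \<otimes> \<one>)"
    using L_left_invariant[of v, unfolded left_invariant_field_def, THEN conjunct2, rule_format,
        of UNIV f x \<one>] f by simp
  ultimately show ?thesis by (simp add: carrier_UNIV)
qed

lemma field_inner: "b \<in> Basis \<Longrightarrow> field v t \<bullet> b = L v (\<lambda>p. c p \<bullet> b) (c' t)"
  by (simp add: field_def inner_sum_left inner_Basis if_distrib cong: if_cong)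

lemma coordinates_derivative:
  "((\<lambda>s. c (x \<otimes> E (s *\<^sub>R v))) has_vector_derivative field v (c x)) (at 0)"
  unfolding has_vector_derivative_def
proof (subst has_derivative_componentwise_within, intro ballI)
  fix b :: 'b assume b: "b \<in> Basis"
  have "((\<lambda>s. c (x \<otimes> E (s *\<^sub>R v)) \<bullet> b) has_derivative (*) (L v (\<lambda>p. c p \<bullet> b) x)) (at 0)"
    using L_eq_derivative[OF smooth_c_inner, of x v b]
    by (simp add: has_field_derivative_def)
  then show "((\<lambda>s. c (x \<otimes> E (s *\<^sub>R v)) \<bullet> b) has_derivative (\<lambda>s. (s *\<^sub>R field v (c x)) \<bullet> b)) (at 0)"
    by (simp add: field_inner[OF b] mult_commute_abs)
qed

text \<open>The chain rule applied to \<open>coordinates_derivative\<close>. Values may lie in any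
  normed space, so complex functions are covered, and differentiability is needed at one point
  only.\<close>

lemma derivative_along_E:
  fixes f :: "'g \<Rightarrow> 'c::real_normed_vector"
  assumes "((\<lambda>t. f (c' t)) has_derivative D) (at (c x))"
  shows "((\<lambda>s. f (x \<otimes> E (s *\<^sub>R v))) has_vector_derivative D (field v (c x))) (at 0)"
proof -
  have lin: "linear D" using assms by (intro bounded_linear.linear has_derivative_bounded_linear)
  have "c (x \<otimes> E (0 *\<^sub>R v)) = c x" by (simp add: carrier_UNIV)
  with assms have "((\<lambda>t. f (c' t)) has_derivative D) (at (c (x \<otimes> E (0 *\<^sub>R v))))" by simp
  from has_derivative_compose[OF coordinates_derivative[unfolded has_vector_derivative_def] this]
  show ?thesis by (simp add: has_vector_derivative_def linear_cmul[OF lin])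
qed

lemma left_inv_deriv_coordinates:
  assumes "((\<lambda>t. f (c' t)) has_derivative D) (at (c x))"
  shows "left_inv_deriv G E v f x = D (field v (c x))"
  unfolding left_inv_deriv_def
  by (rule vector_derivative_at[OF derivative_along_E[OF assms]])

text \<open>Both sides are derivatives at 0 of \<open>f\<close> along the same curve.\<close>

lemma L_coordinates:
  assumes "smooth_fun_on A UNIV f" "((\<lambda>t. f (c' t)) has_derivative D) (at t)"
  shows "L v f (c' t) = D (field v t)"
proof (rule vector_derivative_unique_at)
  show "((\<lambda>s. f (c' t \<otimes> E (s *\<^sub>R v))) has_vector_derivative L v f (c' t)) (at 0)"
    using L_eq_derivative[OF assms(1)] by (simp add: has_real_derivative_iff_has_vector_derivative)
  show "((\<lambda>s. f (c' t \<otimes> E (s *\<^sub>R v))) has_vector_derivative D (field v t)) (at 0)"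
    using derivative_along_E[of f D "c' t" v] assms(2) by simp
qed

section \<open>Linearity, regularity and commutators of the coefficient vectors\<close>

lemma linear_field: "linear (\<lambda>v. field v t)"
proof -
  note lin = linear_L[OF smooth_c_inner]
  show ?thesis
    by (rule linearI) (simp_all add: field_def linear_add[OF lin] linear_cmul[OF lin]
        scaleR_left_distrib sum.distrib scaleR_right.sum)
qed

lemma field_differentiable: "field v differentiable (at t)"
proof (subst differentiable_componentwise_within, intro ballI)
  fix b :: 'b assume b: "b \<in> Basis"
  have "smooth_on UNIV (\<lambda>t. L v (\<lambda>p. c p \<bullet> b) (c' t))"
    using smooth_fun_on_coordinates(2)[OF open_UNIV smooth_L[OF open_UNIV smooth_c_inner]] by simp
  from smooth_onD[OF this, of t] show "(\<lambda>t. field v t \<bullet> b) differentiable (at t)"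
    by (simp add: field_inner[OF b])
qed

text \<open>The commutator of vector fields in coordinates. By \<open>L_coordinates\<close>,
  applying \<open>L u\<close> to the component of \<open>field z\<close> along \<open>b\<close>
  differentiates that component in the direction \<open>field u t\<close>; \<open>L_bracket\<close>
  for each coordinate function then gives the formula.\<close>

lemma field_bracket:
  assumes "(field v has_derivative Dv) (at t)" "(field w has_derivative Dw) (at t)"
  shows "field (br v w) t = Dw (field v t) - Dv (field w t)"
proof (rule euclidean_eqI)
  fix b :: 'b assume b: "b \<in> Basis"
  have *: "L u (L z (\<lambda>p. c p \<bullet> b)) (c' t) = D (field u t) \<bullet> b"
    if "(field z has_derivative D) (at t)" for u z D
  proof (rule L_coordinates[OF smooth_L[OF open_UNIV smooth_c_inner]])
    have "((\<lambda>t. field z t \<bullet> b) has_derivative (\<lambda>y. D y \<bullet> b)) (at t)"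
      by (rule bounded_linear.has_derivative[OF bounded_linear_inner_left that])
    then show "((\<lambda>t. L z (\<lambda>p. c p \<bullet> b) (c' t)) has_derivative (\<lambda>y. D y \<bullet> b)) (at t)"
      by (simp add: field_inner[OF b])
  qed
  show "field (br v w) t \<bullet> b = (Dw (field v t) - Dv (field w t)) \<bullet> b"
    by (simp add: field_inner[OF b] L_bracket[OF smooth_c_inner] *[OF assms(1)] *[OF assms(2)]
        inner_diff_left)
qed

text \<open>\<open>hol\<close> says that the differential of \<open>Q\<close> turns \<open>J\<close>
  into multiplication by \<open>\<i>\<close>, which makes the components of the chart holomorphic.
  As left invariant fields fill each tangent space by \<open>sur\<close>, the same relation
  transports the holomorphy equations of any \<open>f\<close> to complex linearity of its derivative
  in the chart.\<close>

lemma global_holomorphic_chart_coordinates: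
  fixes Q :: "'b \<Rightarrow> complex^'n" and P :: "complex^'n \<Rightarrow> 'b"
  assumes QP: "\<And>z. Q (P z) = z" and PQ: "\<And>t. P (Q t) = t"
    and smQ: "smooth_on UNIV Q" and smP: "smooth_on UNIV P"
    and dQ: "\<And>t. (Q has_derivative DQ t) (at t)"
    and hol: "\<And>t v. DQ t (field (J v) t) = \<i> *s DQ t (field v t)"
    and sur: "\<And>t. surj (\<lambda>v. field v t)"
  shows "global_holomorphic_chart G A E J (\<lambda>p. Q (c p))"
proof -
  let ?F = "\<lambda>p. Q (c p)"
  have "inj ?F" by (rule inj_on_inverseI[where g = "\<lambda>z. c' (P z)"]) (simp add: PQ)
  moreover have "surj ?F" by (rule surjI[where f = "\<lambda>z. c' (P z)"]) (simp add: QP)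
  ultimately have bij: "bij ?F" by (rule bijI)
  have inv: "inv_into UNIV ?F = (\<lambda>z. c' (P z))"
    by (rule Hilbert_Choice.inv_equality) (simp_all add: PQ QP)
  have smF: "smooth_fun_on A UNIV ?F"
    by (rule smooth_fun_on_compose[OF atlas open_UNIV smQ smooth_c])
  have contP: "continuous_on UNIV P"
    using smP[unfolded smooth_on_def, rule_format, of 0] by simp
  have "smooth_into A UNIV (\<lambda>z. c' (P z))"
    unfolding smooth_into_def
  proof (intro conjI ballI, goal_cases)
    case 1
    show ?case using smooth_c' contP
      by (auto simp: smooth_into_def intro: continuous_on_compose2[of UNIV c' UNIV P])
  next
    case (2 x)
    obtain U \<phi> where x: "x = (U, \<phi>)" by (cases x)
    have "open (c' -` U)"
      using smooth_c' chartD(1)[OF atlas 2[unfolded x]] by (simp add: smooth_into_def open_vimage)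
    then have op: "open ((\<lambda>z. c' (P z)) -` U)"
      using open_vimage[OF _ contP, of "c' -` U"] by (simp add: vimage_def)
    have c': "smooth_on (c' -` U) (\<phi> \<circ> c')"
      using smooth_c' 2[unfolded x] by (auto simp: smooth_into_def)
    have P: "smooth_on ((\<lambda>z. c' (P z)) -` U) P"
      by (rule smooth_on_subset[OF smP subset_UNIV])
    have "smooth_on ((\<lambda>z. c' (P z)) -` U) (\<lambda>z. (\<phi> \<circ> c') (P z))"
      by (rule smooth_on_compose[OF op _ c' P]) auto
    then show ?case by (simp add: x comp_def)
  qed
  then have glob: "global_coordinates A ?F"
    using bij smF by (simp add: global_coordinates_def inv)
  have "lie_holomorphic_on G A E J UNIV (\<lambda>p. ?F p $ k)" for k
    unfolding lie_holomorphic_on_def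
  proof (intro conjI ballI allI)
    show "smooth_fun_on A UNIV (\<lambda>p. ?F p $ k)"
      by (rule smooth_fun_on_linear[OF atlas open_UNIV bounded_linear_vec_nth smF])
    fix x v
    have "((\<lambda>t. Q t $ k) has_derivative (\<lambda>u. DQ (c x) u $ k)) (at (c x))"
      by (rule bounded_linear.has_derivative[OF bounded_linear_vec_nth dQ])
    then have "left_inv_deriv G E v (\<lambda>p. ?F p $ k) x = DQ (c x) (field v (c x)) $ k" for v
      by (intro left_inv_deriv_coordinates) simp
    then show "left_inv_deriv G E v (\<lambda>p. ?F p $ k) x + \<i> * left_inv_deriv G E (J v) (\<lambda>p. ?F p $ k) x = 0"
      by (simp add: hol)
  qed
  moreover have "holomorphic_several_on (?F ` W) (f \<circ> inv_into UNIV ?F)"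
    if W: "open W" and f: "lie_holomorphic_on G A E J W f" for W f
    unfolding holomorphic_several_on_def
  proof
    fix z assume z: "z \<in> ?F ` W"
    define t where "t = P z"
    have t: "t \<in> c' -` W" using z by (auto simp: t_def PQ)
    define h where "h = (\<lambda>t. f (c' t))"
    define D where "D = frechet_derivative h (at t)"
    define DP where "DP = frechet_derivative P (at z)"
    have "smooth_fun_on A W f" using f by (simp add: lie_holomorphic_on_def)
    then have "smooth_on (c' -` W) h"
      unfolding h_def by (rule smooth_fun_on_coordinates(2)[OF W])
    then have D: "(h has_derivative D) (at t)"
      using smooth_onD[OF _ t] by (simp add: D_def frechet_derivative_works)
    have DP: "(P has_derivative DP) (at z)"
      using smooth_onD[OF smP] by (simp add: DP_def frechet_derivative_works)
    \<comment> \<open>Differentiating both identities between \<open>P\<close> and \<open>Q\<close>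
      shows that \<open>DP\<close> and \<open>DQ t\<close> are mutually inverse.\<close>
    have "((\<lambda>y. Q (P y)) has_derivative (\<lambda>u. DQ t (DP u))) (at z)"
      using has_derivative_compose[OF DP, of Q "DQ t"] dQ[of t] by (simp add: t_def)
    then have "((\<lambda>y. y) has_derivative (\<lambda>u. DQ t (DP u))) (at z)" by (simp add: QP)
    then have "(\<lambda>u. DQ t (DP u)) = (\<lambda>u. u)"
      by (rule has_derivative_unique[OF _ has_derivative_ident])
    then have QP': "DQ t (DP u) = u" for u by (rule fun_cong)
    have "((\<lambda>s. P (Q s)) has_derivative (\<lambda>u. DP (DQ t u))) (at t)"
      using has_derivative_compose[OF dQ[of t], of P DP] DP by (simp add: t_def QP)
    then have "((\<lambda>y. y) has_derivative (\<lambda>u. DP (DQ t u))) (at t)" by (simp add: PQ)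
    then have "(\<lambda>u. DP (DQ t u)) = (\<lambda>u. u)"
      by (rule has_derivative_unique[OF _ has_derivative_ident])
    then have PQ': "DP (DQ t u) = u" for u by (rule fun_cong)
    have "D (DP (\<i> *s u)) = \<i> * D (DP u)" for u
    proof -
      \<comment> \<open>Holomorphy is stated along left invariant fields, so the tangent vector is
        realised as the value of one.\<close>
      obtain v where v: "DP u = field v t" using surjD[OF sur] by blast
      have "\<i> *s u = DQ t (field (J v) t)" by (simp add: hol v[symmetric] QP')
      then have 1: "DP (\<i> *s u) = field (J v) t" by (simp add: PQ')
      have "left_inv_deriv G E v f (c' t) + \<i> * left_inv_deriv G E (J v) f (c' t) = 0"
        using f t by (auto simp: lie_holomorphic_on_def)
      moreover have "left_inv_deriv G E v f (c' t) = D (field v t)" for v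
        using left_inv_deriv_coordinates[of f D "c' t" v] D by (simp add: h_def)
      ultimately have "D (field v t) + \<i> * D (field (J v) t) = 0" by simp
      \<comment> \<open>Multiplying by \<open>\<i>\<close> turns the coefficient of the
        \<open>J v\<close> term into -1, so that this term can be isolated.\<close>
      then have "\<i> * (D (field v t) + \<i> * D (field (J v) t)) = 0" by simp
      then have "D (field (J v) t) = \<i> * D (field v t)" by (simp add: algebra_simps)
      then show ?thesis by (simp add: 1 v)
    qed
    moreover have "((f \<circ> inv_into UNIV ?F) has_derivative (\<lambda>u. D (DP u))) (at z)"
      using has_derivative_compose[OF DP, of h D] D by (simp add: t_def inv h_def comp_def)
    ultimately show "\<exists>D. ((f \<circ> inv_into UNIV ?F) has_derivative D) (at z) \<and> (\<forall>v. D (\<i> *s v) = \<i> * D v)"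
      by blast
  qed
  ultimately show ?thesis using glob by (simp add: global_holomorphic_chart_def)
qed

end

section \<open>The left invariant vector fields of M14\<close>

lemma exhaust_6:
  fixes x :: 6
  shows "x = 1 \<or> x = 2 \<or> x = 3 \<or> x = 4 \<or> x = 5 \<or> x = 6"
proof (induct x)
  case (of_int z)
  then have "0 \<le> z" "z < 6" by simp_all
  \<comment> \<open>The type 6 is the integers modulo 6, so the case 0 is the index 6.\<close>
  then have "z = 0 \<or> z = 1 \<or> z = 2 \<or> z = 3 \<or> z = 4 \<or> z = 5" by arith
  then show ?case by auto
qed

lemma forall_6: "(\<forall>i::6. P i) \<longleftrightarrow> P 1 \<and> P 2 \<and> P 3 \<and> P 4 \<and> P 5 \<and> P 6"
  by (metis exhaust_6)

lemma vector_6: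
  "(vector [a, b, d, e, f, g] :: 'a::zero^6) $ 1 = a"
  "(vector [a, b, d, e, f, g] :: 'a::zero^6) $ 2 = b"
  "(vector [a, b, d, e, f, g] :: 'a::zero^6) $ 3 = d"
  "(vector [a, b, d, e, f, g] :: 'a::zero^6) $ 4 = e"
  "(vector [a, b, d, e, f, g] :: 'a::zero^6) $ 5 = f"
  "(vector [a, b, d, e, f, g] :: 'a::zero^6) $ 6 = g"
  by (simp_all add: vector_def)

lemma basis_x_nth: "basis_x i $ j = (if j = i then 1 else 0)"
  by (simp add: axis_def)

lemma M14_bracket_basis_zero:
  "M14_bracket (basis_x 1) (basis_x 5) = 0" "M14_bracket (basis_x 1) (basis_x 6) = 0"
  "M14_bracket (basis_x 2) (basis_x 4) = 0" "M14_bracket (basis_x 2) (basis_x 6) = 0"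
  by (simp_all add: M14_bracket_def basis_x_nth)

lemma basis_x_expansion:
  "v = v$1 *\<^sub>R basis_x 1 + v$2 *\<^sub>R basis_x 2 + v$3 *\<^sub>R basis_x 3
     + v$4 *\<^sub>R basis_x 4 + v$5 *\<^sub>R basis_x 5 + v$6 *\<^sub>R basis_x 6"
  unfolding vec_eq_iff forall_6 by (simp add: basis_x_nth)

lemma affine_if_constant_derivative:
  fixes g :: "real \<Rightarrow> 'a::real_normed_vector"
  assumes "\<And>s. (g has_vector_derivative u) (at s)"
  shows "g s = g 0 + s *\<^sub>R u"
proof -
  have "((\<lambda>s. g s - s *\<^sub>R u) has_vector_derivative 0) (at s)" for s
    by (auto intro!: derivative_eq_intros assms)
  then have "((\<lambda>s. g s - s *\<^sub>R u) has_derivative (\<lambda>h. 0)) (at s)" for s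
    by (simp add: has_vector_derivative_def)
  from has_derivative_zero_constant[OF convex_UNIV this]
  obtain a where "\<And>s. g s - s *\<^sub>R u = a" by auto
  from this[of s] this[of 0] show ?thesis by (simp add: algebra_simps)
qed

locale M14_coordinates = lie_group_coordinates G A M14_bracket L E c
  for G :: "'g::{t2_space,second_countable_topology} monoid" (structure)
    and A :: "('g set \<times> ('g \<Rightarrow> 'e::euclidean_space)) set"
    and L :: "real^6 \<Rightarrow> ('g \<Rightarrow> real) \<Rightarrow> 'g \<Rightarrow> real"
    and E :: "real^6 \<Rightarrow> 'g"
    and c :: "'g \<Rightarrow> real^6" +
  assumes second_kind: "p = E (c p $ 1 *\<^sub>R basis_x 1) \<otimes> E (c p $ 2 *\<^sub>R basis_x 2)
      \<otimes> E (c p $ 3 *\<^sub>R basis_x 3) \<otimes> E (c p $ 4 *\<^sub>R basis_x 4) \<otimes> E (c p $ 5 *\<^sub>R basis_x 5)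
      \<otimes> E (c p $ 6 *\<^sub>R basis_x 6)"
begin

section \<open>Fields on slices and their propagation along constant fields\<close>

lemma c'_eq: "c' t = E (t $ 1 *\<^sub>R basis_x 1) \<otimes> E (t $ 2 *\<^sub>R basis_x 2)
      \<otimes> E (t $ 3 *\<^sub>R basis_x 3) \<otimes> E (t $ 4 *\<^sub>R basis_x 4) \<otimes> E (t $ 5 *\<^sub>R basis_x 5)
      \<otimes> E (t $ 6 *\<^sub>R basis_x 6)"
  using second_kind[of "c' t"] by simp

lemma field_zero [simp]: "field 0 t = 0"
  by (rule linear_0[OF linear_field])

lemma field_if_translation:
  assumes "\<And>s. c' t \<otimes> E (s *\<^sub>R v) = c' (t + s *\<^sub>R w)"
  shows "field v t = w"
proof (rule vector_derivative_unique_at)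
  show "((\<lambda>s. t + s *\<^sub>R w) has_vector_derivative field v t) (at 0)"
    using coordinates_derivative[of "c' t" v] by (simp add: assms)
  show "((\<lambda>s. t + s *\<^sub>R w) has_vector_derivative w) (at 0)"
    by (auto intro!: derivative_eq_intros)
qed

text \<open>If all coordinates after the \<open>j\<close>-th vanish, the later factors of
  \<open>c' t\<close> are \<open>E 0\<close>, the identity. Right multiplication by
  \<open>E (s *\<^sub>R basis_x j)\<close> then merges with the \<open>j\<close>-th factor and only
  adds \<open>s\<close> to that coordinate.\<close>

lemma field_on_slice:
  "field (basis_x 6) t = basis_x 6"
  "t$6 = 0 \<Longrightarrow> field (basis_x 5) t = basis_x 5"
  "t$5 = 0 \<Longrightarrow> t$6 = 0 \<Longrightarrow> field (basis_x 4) t = basis_x 4"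
  "t$4 = 0 \<Longrightarrow> t$5 = 0 \<Longrightarrow> t$6 = 0 \<Longrightarrow> field (basis_x 3) t = basis_x 3"
  "t$3 = 0 \<Longrightarrow> t$4 = 0 \<Longrightarrow> t$5 = 0 \<Longrightarrow> t$6 = 0 \<Longrightarrow> field (basis_x 2) t = basis_x 2"
  "t$2 = 0 \<Longrightarrow> t$3 = 0 \<Longrightarrow> t$4 = 0 \<Longrightarrow> t$5 = 0 \<Longrightarrow> t$6 = 0 \<Longrightarrow>
     field (basis_x 1) t = basis_x 1"
  by (rule field_if_translation; simp add: c'_eq E_add m_assoc carrier_UNIV basis_x_nth)+

text \<open>For a constant \<open>field w\<close>, \<open>field_bracket\<close> reduces to minus the
  derivative of \<open>field v\<close> along \<open>w'\<close>. This derivative is therefore the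
  constant \<open>- u\<close>, and \<open>field v\<close> is affine along lines in direction
  \<open>w'\<close>.\<close>

lemma field_along_constant_field:
  assumes w: "\<And>t. field w t = w'" and br: "\<And>t. field (M14_bracket v w) t = u"
  shows "field v (t + s *\<^sub>R w') = field v t - s *\<^sub>R u"
proof -
  have "((\<lambda>s. field v (t + s *\<^sub>R w')) has_vector_derivative - u) (at s)" for s
  proof -
    let ?D = "frechet_derivative (field v) (at (t + s *\<^sub>R w'))"
    have D: "(field v has_derivative ?D) (at (t + s *\<^sub>R w'))"
      using field_differentiable frechet_derivative_works by blast
    have "field w = (\<lambda>t. w')" using w by auto
    then have "(field w has_derivative (\<lambda>_. 0)) (at (t + s *\<^sub>R w'))" by simp
    from field_bracket[OF D this] have "?D w' = - u" by (simp add: w br)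
    moreover have "((\<lambda>s. t + s *\<^sub>R w') has_vector_derivative w') (at s)"
      by (auto intro!: derivative_eq_intros)
    from has_derivative_compose[OF this[unfolded has_vector_derivative_def] D]
    have "((\<lambda>s. field v (t + s *\<^sub>R w')) has_derivative (\<lambda>h. ?D (h *\<^sub>R w'))) (at s)" .
    ultimately show ?thesis
      using linear_cmul[OF has_derivative_linear[OF D]] by (simp add: has_vector_derivative_def)
  qed
  from affine_if_constant_derivative[OF this, of s] show ?thesis by simp
qed

text \<open>Moves \<open>t\<close> along \<open>basis_x k\<close> until its \<open>k\<close>-th
  coordinate is 0, the starting point for reaching a slice of \<open>field_on_slice\<close>.\<close>

lemma field_shear:
  assumes w: "\<And>t. field (basis_x k) t = basis_x k"
    and br: "\<And>t. field (M14_bracket v (basis_x k)) t = u"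
  shows "field v t = field v (t - t$k *\<^sub>R basis_x k) - t$k *\<^sub>R u"
  using field_along_constant_field[OF w br, of "t - t$k *\<^sub>R basis_x k" "t$k"] by simp

section \<open>The six basis fields, from the last to the first\<close>

lemmas field_basis_6 = field_on_slice(1)

lemma field_basis_5: "field (basis_x 5) t = basis_x 5"
proof -
  have "field (basis_x 5) t = field (basis_x 5) (t - t$6 *\<^sub>R basis_x 6)"
    using field_shear[OF field_basis_6, of "basis_x 5" 0 t] by (simp add: M14_bracket_def basis_x_nth)
  then show ?thesis by (simp add: field_on_slice basis_x_nth)
qed

lemma field_basis_4: "field (basis_x 4) t = basis_x 4"
proof -
  have *: "field (basis_x 4) t = field (basis_x 4) (t - t$6 *\<^sub>R basis_x 6)"
    "field (basis_x 4) t = field (basis_x 4) (t - t$5 *\<^sub>R basis_x 5)" for t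
    using field_shear[OF field_basis_6, of "basis_x 4" 0 t]
      field_shear[OF field_basis_5, of "basis_x 4" 0 t] by (simp_all add: M14_bracket_def basis_x_nth)
  \<comment> \<open>Coordinates 6 and 5 are cleared in turn; the brackets with
    \<open>basis_x 6\<close> and \<open>basis_x 5\<close> vanish, so nothing is picked up on the way
    to the slice.\<close>
  show ?thesis by (subst *(1), subst *(2)) (simp add: field_on_slice basis_x_nth)
qed

lemma field_basis_3: "field (basis_x 3) t = basis_x 3"
proof -
  have *: "field (basis_x 3) t = field (basis_x 3) (t - t$6 *\<^sub>R basis_x 6)"
    "field (basis_x 3) t = field (basis_x 3) (t - t$5 *\<^sub>R basis_x 5)"
    "field (basis_x 3) t = field (basis_x 3) (t - t$4 *\<^sub>R basis_x 4)" for t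
    using field_shear[OF field_basis_6, of "basis_x 3" 0 t]
      field_shear[OF field_basis_5, of "basis_x 3" 0 t]
      field_shear[OF field_basis_4, of "basis_x 3" 0 t] by (simp_all add: M14_bracket_def basis_x_nth)
  show ?thesis by (subst *(1), subst *(2), subst *(3)) (simp add: field_on_slice basis_x_nth)
qed

lemma field_basis_2: "field (basis_x 2) t = basis_x 2 - t$3 *\<^sub>R basis_x 5 - t$5 *\<^sub>R basis_x 6"
proof -
  have a: "field (basis_x 2) t = field (basis_x 2) (t - t$6 *\<^sub>R basis_x 6)" for t
    using field_shear[OF field_basis_6, of "basis_x 2" 0 t]
    by (simp add: M14_bracket_basis M14_bracket_basis_zero)
  have b: "field (basis_x 2) t = field (basis_x 2) (t - t$5 *\<^sub>R basis_x 5) - t$5 *\<^sub>R basis_x 6" for t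
    using field_shear[OF field_basis_5, of "basis_x 2" "basis_x 6" t]
    by (simp add: M14_bracket_basis M14_bracket_basis_zero field_basis_6)
  have c: "field (basis_x 2) t = field (basis_x 2) (t - t$4 *\<^sub>R basis_x 4)" for t
    using field_shear[OF field_basis_4, of "basis_x 2" 0 t]
    by (simp add: M14_bracket_basis M14_bracket_basis_zero)
  have d: "field (basis_x 2) t = field (basis_x 2) (t - t$3 *\<^sub>R basis_x 3) - t$3 *\<^sub>R basis_x 5" for t
    using field_shear[OF field_basis_3, of "basis_x 2" "basis_x 5" t]
    by (simp add: M14_bracket_basis M14_bracket_basis_zero field_basis_5)
  show ?thesis
    \<comment> \<open>Clearing coordinates 6, 5, 4, 3 reaches the slice. Only 5 and 3 contribute,
      through \<open>[x2, x5] = x6\<close> and \<open>[x2, x3] = x5\<close>.\<close>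
    by (subst a, subst b, subst c, subst d) (simp add: field_on_slice basis_x_nth)
qed

text \<open>
  On the plane \<open>t\<^sub>3 = \<dots> = t\<^sub>6 = 0\<close> the field of \<open>x\<^sub>2\<close> is \<open>\<partial>\<^sub>2\<close>, and the relation
  \<open>[x\<^sub>1, x\<^sub>2] = 0\<close> is a triangular linear system of differential equations along it.
\<close>

lemma field_basis_1_slice:
  assumes "t$3 = 0" "t$4 = 0" "t$5 = 0" "t$6 = 0"
  shows "field (basis_x 1) t = basis_x 1"
proof -
  \<comment> \<open>The line through \<open>t\<close> in direction \<open>basis_x 2\<close>: at
    \<open>s = 0\<close> it meets the slice where \<open>field (basis_x 1)\<close> is known, and at
    \<open>s = t$2\<close> it is at \<open>t\<close>. \<open>field_shear\<close> does not apply
    because \<open>field (basis_x 2)\<close> is not constant near the line.\<close>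
  define r where "r s = t - t$2 *\<^sub>R basis_x 2 + s *\<^sub>R basis_x 2" for s
  define g where "g s = field (basis_x 1) (r s)" for s
  have r0: "field (basis_x 1) (r 0) = basis_x 1"
    by (rule field_on_slice(6)) (simp_all add: r_def assms basis_x_nth)
  have slice: "field (basis_x 2) (r s) = basis_x 2" for s
    by (rule field_on_slice(5)) (simp_all add: r_def assms basis_x_nth)
  have g': "(g has_vector_derivative - (g s $ 3) *\<^sub>R basis_x 5 - (g s $ 5) *\<^sub>R basis_x 6) (at s)" for s
  proof -
    let ?D = "frechet_derivative (field (basis_x 1)) (at (r s))"
    have D: "(field (basis_x 1) has_derivative ?D) (at (r s))"
      using field_differentiable frechet_derivative_works by blast
    have "field (basis_x 2) = (\<lambda>t. basis_x 2 - t$3 *\<^sub>R basis_x 5 - t$5 *\<^sub>R basis_x 6)"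
      using field_basis_2 by auto
    then have "(field (basis_x 2) has_derivative
        (\<lambda>u. - (u$3) *\<^sub>R basis_x 5 - u$5 *\<^sub>R basis_x 6)) (at (r s))"
      by (auto intro!: derivative_eq_intros bounded_linear.has_derivative[OF bounded_linear_vec_nth])
    \<comment> \<open>Since the bracket of \<open>basis_x 1\<close> and \<open>basis_x 2\<close> is
      0, the derivative of \<open>field (basis_x 1)\<close> along \<open>basis_x 2\<close> is the
      derivative of \<open>field (basis_x 2)\<close> in the direction \<open>g s\<close>.\<close>
    from field_bracket[OF D this]
    have D2: "?D (basis_x 2) = - (g s $ 3) *\<^sub>R basis_x 5 - (g s $ 5) *\<^sub>R basis_x 6"
      by (simp add: M14_bracket_def basis_x_nth slice g_def)
    have "(r has_vector_derivative basis_x 2) (at s)"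
      unfolding r_def by (auto intro!: derivative_eq_intros)
    from has_derivative_compose[OF this[unfolded has_vector_derivative_def] D]
    have "(g has_derivative (\<lambda>h. ?D (h *\<^sub>R basis_x 2))) (at s)" by (simp add: g_def[abs_def])
    then show ?thesis
      using linear_cmul[OF has_derivative_linear[OF D]] D2 by (simp add: has_vector_derivative_def)
  qed
  note nth = bounded_linear.has_vector_derivative[OF bounded_linear_vec_nth g']
  \<comment> \<open>The right-hand side has components 5 and 6 only. So component 3 keeps its
    initial value 0, then component 5 does, and finally \<open>g\<close> is constant.\<close>
  have "((\<lambda>s. g s $ 3) has_vector_derivative 0) (at s)" for s
    using nth[of 3 s] by (simp add: basis_x_nth)
  from affine_if_constant_derivative[OF this] have g3: "g s $ 3 = 0" for s
    by (simp add: g_def[of 0] r0 basis_x_nth)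
  have "((\<lambda>s. g s $ 5) has_vector_derivative 0) (at s)" for s
    using nth[of 5 s] by (simp add: basis_x_nth g3)
  from affine_if_constant_derivative[OF this] have g5: "g s $ 5 = 0" for s
    by (simp add: g_def[of 0] r0 basis_x_nth)
  have "(g has_vector_derivative 0) (at s)" for s using g'[of s] by (simp add: g3 g5)
  from affine_if_constant_derivative[OF this, of "t$2"] show ?thesis
    by (simp add: g_def r0) (simp add: r_def)
qed

lemma field_basis_1: "field (basis_x 1) t = basis_x 1 - t$3 *\<^sub>R basis_x 4 - t$4 *\<^sub>R basis_x 6"
proof -
  have a: "field (basis_x 1) t = field (basis_x 1) (t - t$6 *\<^sub>R basis_x 6)" for t
    using field_shear[OF field_basis_6, of "basis_x 1" 0 t]
    by (simp add: M14_bracket_basis M14_bracket_basis_zero)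
  have b: "field (basis_x 1) t = field (basis_x 1) (t - t$5 *\<^sub>R basis_x 5)" for t
    using field_shear[OF field_basis_5, of "basis_x 1" 0 t]
    by (simp add: M14_bracket_basis M14_bracket_basis_zero)
  have c: "field (basis_x 1) t = field (basis_x 1) (t - t$4 *\<^sub>R basis_x 4) - t$4 *\<^sub>R basis_x 6" for t
    using field_shear[OF field_basis_4, of "basis_x 1" "basis_x 6" t]
    by (simp add: M14_bracket_basis M14_bracket_basis_zero field_basis_6)
  have d: "field (basis_x 1) t = field (basis_x 1) (t - t$3 *\<^sub>R basis_x 3) - t$3 *\<^sub>R basis_x 4" for t
    using field_shear[OF field_basis_3, of "basis_x 1" "basis_x 4" t]
    by (simp add: M14_bracket_basis M14_bracket_basis_zero field_basis_4)
  show ?thesis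
    \<comment> \<open>Here coordinates 4 and 3 contribute, and coordinate 2 may stay nonzero thanks
      to \<open>field_basis_1_slice\<close>.\<close>
    by (subst a, subst b, subst c, subst d) (simp add: field_basis_1_slice basis_x_nth)
qed

lemma field_components:
  "field v t $ 1 = v$1" "field v t $ 2 = v$2" "field v t $ 3 = v$3"
  "field v t $ 4 = v$4 - t$3 * v$1" "field v t $ 5 = v$5 - t$3 * v$2"
  "field v t $ 6 = v$6 - t$4 * v$1 - t$5 * v$2"
  by (subst basis_x_expansion[of v],
      simp add: linear_add[OF linear_field] linear_cmul[OF linear_field] field_basis_1 field_basis_2
        field_basis_3 field_basis_4 field_basis_5 field_basis_6 basis_x_nth)+

text \<open>By \<open>field_components\<close> the map is triangular with unit diagonal; the witness
  solves the equations from the first component down.\<close>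

lemma surj_field: "surj (\<lambda>v. field v t)"
proof (rule surjI)
  fix u :: "real^6"
  show "field (vector [u$1, u$2, u$3, u$4 + t$3 * u$1, u$5 + t$3 * u$2,
      u$6 + t$4 * u$1 + t$5 * u$2]) t = u"
    unfolding vec_eq_iff forall_6 by (simp add: field_components vector_6)
qed

end

section \<open>The polynomial chart, its inverse and the holomorphy identities\<close>

theorem mainTheorem15:
  fixes G :: "'g::{t2_space,second_countable_topology} monoid"
    and A :: "('g set \<times> ('g \<Rightarrow> real^6)) set"
    and L :: "real^6 \<Rightarrow> ('g \<Rightarrow> real) \<Rightarrow> 'g \<Rightarrow> real"
    and E :: "real^6 \<Rightarrow> 'g"
    and J :: "real^6 \<Rightarrow> real^6"
    and \<epsilon> :: real
    and x1 y1 x2 y2 x3 y3 :: "'g \<Rightarrow> real"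
    and w1 w2 w3 \<phi>1 \<phi>2 \<phi>3 :: "'g \<Rightarrow> complex"
  assumes "\<epsilon> \<in> {1, -1}"
    and "lie_group G A"
    and "connected (UNIV :: 'g set)"
    and "simply_connected (UNIV :: 'g set)"
    and "lie_algebra_iso G A M14_bracket L"
    and "exponential_map G A L E"
    and "global_coordinates A
      (\<lambda>p. vector [x1 p, y1 p, x2 p, y2 p, x3 p, y3 p] :: real^6)"
    and "\<forall>p. p = E (x1 p *\<^sub>R basis_x 1) \<otimes>\<^bsub>G\<^esub> E (y1 p *\<^sub>R basis_x 2) \<otimes>\<^bsub>G\<^esub> E (x2 p *\<^sub>R basis_x 3)
      \<otimes>\<^bsub>G\<^esub> E (y2 p *\<^sub>R basis_x 4) \<otimes>\<^bsub>G\<^esub> E (x3 p *\<^sub>R basis_x 5) \<otimes>\<^bsub>G\<^esub> E (y3 p *\<^sub>R basis_x 6)"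
    and "complex_structure M14_bracket J"
    and "J (basis_x 1) = basis_x 2"
    and "J (basis_x 4) = basis_x 5"
    and "J (basis_x 6) = \<epsilon> *\<^sub>R basis_x 3"
    and "\<forall>p. w1 p = x1 p + \<i> * y1 p"
    and "\<forall>p. w2 p = x2 p - \<i> * \<epsilon> * y3 p"
    and "\<forall>p. w3 p = x3 p - \<i> * y2 p"
    and "\<forall>p. \<phi>1 p = w1 p"
    and "\<forall>p. \<phi>2 p = w2 p + \<epsilon> / 2 * w3 p * cnj (w1 p)"
    and "\<forall>p. \<phi>3 p = w3 p"
  shows "lie_holomorphic_on G A E J UNIV \<phi>1
    \<and> lie_holomorphic_on G A E J UNIV \<phi>2
    \<and> lie_holomorphic_on G A E J UNIV \<phi>3
    \<and> global_holomorphic_chart G A E J (\<lambda>p. vector [\<phi>1 p, \<phi>2 p, \<phi>3 p] :: complex^3)"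
proof -
  define c where "c p = (vector [x1 p, y1 p, x2 p, y2 p, x3 p, y3 p] :: real^6)" for p
  \<comment> \<open>\<open>Q\<close> is the chart read in the coordinates, written with sums and
    products only so that the closure rules for \<open>Ck_on\<close> match it.\<close>
  define Q :: "real^6 \<Rightarrow> complex^3" where "Q t = vector [of_real (t$1) + \<i> * of_real (t$2),
      of_real (t$3) + (- \<i> * \<epsilon>) * of_real (t$6)
        + \<epsilon> / 2 * ((of_real (t$5) + (- \<i>) * of_real (t$4)) * (of_real (t$1) + (- \<i>) * of_real (t$2))),
      of_real (t$5) + (- \<i>) * of_real (t$4)]" for t
  \<comment> \<open>Recovers the function \<open>w2\<close> from the chart values by removing the
    correction term. As its imaginary part is \<open>- \<epsilon> * y3\<close> and
    \<open>\<epsilon>\<close> squares to 1, the last entry of \<open>P\<close> returns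
    \<open>y3\<close>.\<close>
  define w where "w z = z$2 + (- \<epsilon> / 2) * (z$3 * cnj (z$1))" for z :: "complex^3"
  define P :: "complex^3 \<Rightarrow> real^6" where
    "P z = vector [Re (z$1), Im (z$1), Re (w z), - Im (z$3), Re (z$3), - \<epsilon> * Im (w z)]" for z
  define DQ where "DQ t = frechet_derivative Q (at t)" for t

  interpret lie_group G A by fact
  interpret M14_coordinates G A L E c
  proof
    show "global_coordinates A c" using assms(7) by (simp add: c_def[abs_def])
    show "p = E (c p $ 1 *\<^sub>R basis_x 1) \<otimes>\<^bsub>G\<^esub> E (c p $ 2 *\<^sub>R basis_x 2)
      \<otimes>\<^bsub>G\<^esub> E (c p $ 3 *\<^sub>R basis_x 3) \<otimes>\<^bsub>G\<^esub> E (c p $ 4 *\<^sub>R basis_x 4) \<otimes>\<^bsub>G\<^esub> E (c p $ 5 *\<^sub>R basis_x 5)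
      \<otimes>\<^bsub>G\<^esub> E (c p $ 6 *\<^sub>R basis_x 6)" for p
      using assms(8) by (simp add: c_def vector_6)
  qed fact+

  have \<epsilon>: "\<epsilon> * \<epsilon> = 1" using assms(1) by auto
  have linJ: "linear J" and JJ: "J (J v) = - v" for v
    using assms(9) by (auto simp: complex_structure_def)
  \<comment> \<open>The values of \<open>J\<close> that are not given follow from
    \<open>J (J v) = - v\<close>.\<close>
  have J2: "J (basis_x 2) = - basis_x 1" using JJ[of "basis_x 1"] assms(10) by simp
  have J5: "J (basis_x 5) = - basis_x 4" using JJ[of "basis_x 4"] assms(11) by simp
  have "\<epsilon> *\<^sub>R J (basis_x 3) = - basis_x 6"
    using JJ[of "basis_x 6"] assms(12) by (simp add: linear_cmul[OF linJ])
  then have "\<epsilon> *\<^sub>R \<epsilon> *\<^sub>R J (basis_x 3) = - \<epsilon> *\<^sub>R basis_x 6" by simp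
  then have J3: "J (basis_x 3) = - \<epsilon> *\<^sub>R basis_x 6" by (simp add: \<epsilon>)
  have J: "J v = vector [- (v$2), v$1, \<epsilon> * v$6, - (v$5), v$4, - \<epsilon> * v$3]" for v
    by (subst basis_x_expansion[of v])
      (simp add: vec_eq_iff forall_6 vector_6 linear_add[OF linJ] linear_cmul[OF linJ] assms(10-12)
        J2 J3 J5 basis_x_nth)

  have Ck_nth: "Ck_on k UNIV (\<lambda>t::real^6. complex_of_real (t $ i))" for k i
    by (intro Ck_on_bounded_linear[OF open_UNIV bounded_linear_of_real]
        Ck_on_bounded_linear[OF open_UNIV bounded_linear_vec_nth] Ck_on_id)
  have Ck_nth': "Ck_on k UNIV (\<lambda>z::complex^3. z $ i)" for k i
    by (intro Ck_on_bounded_linear[OF open_UNIV bounded_linear_vec_nth] Ck_on_id)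
  note Ck_mult = Ck_on_bilinear[OF open_UNIV bounded_bilinear_mult]
  have "Ck_on k UNIV (\<lambda>t. Q t $ i)" for k i
    using exhaust_3[of i] unfolding Q_def
    by (elim disjE; simp only: vector_3; intro Ck_on_add[OF open_UNIV] Ck_mult Ck_on_const Ck_nth)
  then have smQ: "smooth_on UNIV Q"
    unfolding smooth_on_def by (intro allI Ck_on_vec_lambda[OF open_UNIV])
  have Ck_w: "Ck_on k UNIV w" for k
    unfolding w_def[abs_def]
    by (intro Ck_on_add[OF open_UNIV] Ck_mult Ck_on_const Ck_nth'
        Ck_on_bounded_linear[OF open_UNIV bounded_linear_cnj])
  note Ck_Re = Ck_on_bounded_linear[OF open_UNIV bounded_linear_Re]
  note Ck_Im = Ck_on_bounded_linear[OF open_UNIV bounded_linear_Im]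
  note Ck_minus = Ck_on_bounded_linear[OF open_UNIV bounded_linear_minus[OF bounded_linear_ident]]
  have "Ck_on k UNIV (\<lambda>z. P z $ i)" for k i
    using exhaust_6[of i] unfolding P_def
    by (elim disjE; simp only: vector_6; intro Ck_mult Ck_on_const Ck_minus Ck_Re Ck_Im Ck_nth' Ck_w)
  then have smP: "smooth_on UNIV P"
    unfolding smooth_on_def by (intro allI Ck_on_vec_lambda[OF open_UNIV])

  have QP: "Q (P z) = z" for z
    using assms(1) by (auto simp: vec_eq_iff forall_3 Q_def P_def w_def vector_6 complex_eq_iff field_simps)
  have PQ: "P (Q t) = t" for t
    using assms(1) by (auto simp: vec_eq_iff forall_6 Q_def P_def w_def vector_6 field_simps)

  have dQ: "(Q has_derivative DQ t) (at t)" for t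
    using smooth_onD[OF smQ] by (simp add: DQ_def frechet_derivative_works)
  have DQ: "DQ t u $ i = D u"
    if "((\<lambda>t. Q t $ i) has_derivative D) (at t)" for t u i D
    using has_derivative_unique[OF bounded_linear.has_derivative[OF bounded_linear_vec_nth dQ] that]
    by (rule fun_cong)
  note nth = bounded_linear.has_derivative[OF bounded_linear_vec_nth has_derivative_ident]
  have DQ1: "DQ t u $ 1 = of_real (u$1) + \<i> * of_real (u$2)" for t u
    by (rule DQ) (auto simp: Q_def intro!: derivative_eq_intros nth)
  have DQ2: "DQ t u $ 2 = of_real (u$3) - \<i> * \<epsilon> * of_real (u$6)
      + \<epsilon> / 2 * ((of_real (t$5) - \<i> * of_real (t$4)) * (of_real (u$1) - \<i> * of_real (u$2))
        + (of_real (u$5) - \<i> * of_real (u$4)) * (of_real (t$1) - \<i> * of_real (t$2)))" for t u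
    by (rule DQ) (auto simp: Q_def intro!: derivative_eq_intros nth)
  have DQ3: "DQ t u $ 3 = of_real (u$5) - \<i> * of_real (u$4)" for t u
    by (rule DQ) (auto simp: Q_def intro!: derivative_eq_intros nth)
  \<comment> \<open>The sixth field component puts the term
    \<open>\<i> * \<epsilon> * (t$4 * v$1 + t$5 * v$2)\<close> into the derivative of
    \<open>w2\<close>. Its antilinear part is \<open>- \<epsilon> / 2\<close> times
    \<open>w3\<close> times the derivative of \<open>cnj w1\<close>, which the correction term in
    \<open>\<phi>2\<close> cancels.\<close>
  have hol: "DQ t (field (J v) t) = \<i> *s DQ t (field v t)" for t v
    using assms(1)
    by (auto simp: vec_eq_iff forall_3 DQ1 DQ2 DQ3 field_components J vector_6 complex_eq_iff field_simps)

  have F: "vector [\<phi>1 p, \<phi>2 p, \<phi>3 p] = Q (c p)" for p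
    using assms(13-18) by (simp add: Q_def c_def vector_6 mult.assoc)
  have main: "global_holomorphic_chart G A E J (\<lambda>p. vector [\<phi>1 p, \<phi>2 p, \<phi>3 p] :: complex^3)"
    unfolding F by (rule global_holomorphic_chart_coordinates[OF QP PQ smQ smP dQ hol surj_field])
  then have "lie_holomorphic_on G A E J UNIV (\<lambda>p. (vector [\<phi>1 p, \<phi>2 p, \<phi>3 p] :: complex^3) $ k)" for k
    by (simp add: global_holomorphic_chart_def)
  from this[of 1] this[of 2] this[of 3] main show ?thesis by simp
qed

end
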